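(* Let $r(t)$ be a real-valued continuous function on $[t_0,+\infty)$. If all solutions of the equation $\phi''+r(t)\phi=0$, $t\ge t_0$, are bounded on $[t_0,+\infty)$, then the equation is oscillatory, and for each of its nontrivial solutions $\phi(t)$ one has $\phi'(t)\not\to 0$ as $t\to+\infty$.
   Context: All solutions are real-valued. The equation is called oscillatory if each of its nontrivial solutions has arbitrarily large zeros. *)

theory Defs
  imports "HOL-Analysis.Analysis"
begin

(* Functions on [t0, oo) are total functions whose values below t0 are irrelevant;
   the derivatives at t0 are one-sided. *)
definition solution :: "(real \<Rightarrow> real) \<Rightarrow> real \<Rightarrow> (real \<Rightarrow> real) \<Rightarrow> bool" where
  "solution r t0 \<phi> \<longleftrightarrow>
     (\<exists>\<phi>' \<phi>''. \<forall>t\<ge>t0.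
        (\<phi> has_real_derivative \<phi>' t) (at t within {t0..}) \<and>
        (\<phi>' has_real_derivative \<phi>'' t) (at t within {t0..}) \<and>
        \<phi>'' t + r t * \<phi> t = 0)"

definition nontrivial_solution :: "(real \<Rightarrow> real) \<Rightarrow> real \<Rightarrow> (real \<Rightarrow> real) \<Rightarrow> bool" where
  "nontrivial_solution r t0 \<phi> \<longleftrightarrow> solution r t0 \<phi> \<and> (\<exists>t\<ge>t0. \<phi> t \<noteq> 0)"

definition oscillatory :: "(real \<Rightarrow> real) \<Rightarrow> real \<Rightarrow> bool" where
  "oscillatory r t0 \<longleftrightarrow>
     (\<forall>\<phi>. nontrivial_solution r t0 \<phi> \<longrightarrow> (\<forall>T. \<exists>t\<ge>t0. t \<ge> T \<and> \<phi> t = 0))"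

end

theory Submission imports Defs begin

text \<open>
  Boundedness of all solutions is only useful if enough solutions exist. Instead of an
  existence theorem, the proof produces from one nontrivial solution \<open>\<phi>\<close> an explicit companion
  \<open>\<psi>\<close> with Wronskian \<open>\<phi> \<psi>' - \<phi>' \<psi> = 1\<close>, by the Rofe-Beketov formula
  \<open>\<psi> = c \<phi> - \<phi>' / (\<phi>\<^sup>2 + \<phi>'\<^sup>2)\<close> with
  \<open>c' = (1 - r) (\<phi>\<^sup>2 - \<phi>'\<^sup>2) / (\<phi>\<^sup>2 + \<phi>'\<^sup>2)\<^sup>2\<close> (lemma \<open>unit_wronskian_partner\<close>). Unlike the classical
  reduction of order \<open>\<psi> = \<phi> \<integral> 1 / \<phi>\<^sup>2\<close>, it is not disturbed by zeros of \<open>\<phi>\<close>; it only needs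
  \<open>\<phi>\<close> and \<open>\<phi>'\<close> to have no common zero, a Gronwall estimate (lemma \<open>energy_positive\<close>).

  Suppose that \<open>\<phi>\<close> has no zeros from some point on. Then \<open>(\<psi> / \<phi>)' = 1 / \<phi>\<^sup>2\<close> is bounded
  away from 0, so \<open>\<psi> / \<phi>\<close> tends to infinity (lemma \<open>quotient_tends_to_infinity\<close>). In particular
  \<open>\<psi>\<close> is eventually nonzero too, and the same argument applied to the pair \<open>\<psi>, -\<phi>\<close>, which again
  has Wronskian 1, shows that \<open>-\<phi> / \<psi>\<close> tends to infinity. The two quotients have opposite
  signs, a contradiction. Hence the equation is oscillatory.

  At the zeros of \<open>\<phi>\<close> the Wronskian identity reads \<open>\<phi>' \<psi> = -1\<close>. They are arbitrarily
  large and \<open>\<psi>\<close> is bounded, so \<open>\<phi>'\<close> cannot tend to 0.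
\<close>

section \<open>Calculus on a half-line\<close>

lemma antiderivative_on_half_line:
  fixes g :: "real \<Rightarrow> real"
  assumes "continuous_on {a..} g"
  obtains G where "\<And>t. t \<ge> a \<Longrightarrow> (G has_real_derivative g t) (at t within {a..})"
proof
  fix t assume t: "t \<ge> a"
  have "continuous_on {a..t + 1} g"
    by (rule continuous_on_subset[OF assms]) auto
  then have "((\<lambda>x. integral {a..x} g) has_real_derivative g t) (at t within {a..t + 1})"
    using t by (intro integral_has_real_derivative) auto
  moreover have "at t within {a..t + 1} = at t within {a..}"
    by (rule at_within_nhd[where S = "{..<t + 1}"]) auto
  ultimately show "((\<lambda>x. integral {a..x} g) has_real_derivative g t) (at t within {a..})"
    by simp
qed

lemma increment_ge_of_derivative_ge:
  fixes f :: "real \<Rightarrow> real"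
  assumes f: "\<And>x. x \<ge> a \<Longrightarrow> (f has_real_derivative f' x) (at x within {a..})"
    and f'_ge: "\<And>x. x \<ge> a \<Longrightarrow> f' x \<ge> k"
    and "a \<le> s" "s \<le> t"
  shows "f t - f s \<ge> k * (t - s)"
proof (cases "s = t")
  case False
  then have "s < t" using assms by simp
  have "\<exists>x\<in>{s<..<t}. f t - f s = (\<lambda>h. f' x * h) (t - s)"
  proof (rule mvt_simple[OF \<open>s < t\<close>])
    fix x assume "s \<le> x" "x \<le> t"
    then show "(f has_derivative (\<lambda>h. f' x * h)) (at x within {s..t})"
      using f[of x] \<open>a \<le> s\<close> unfolding has_field_derivative_def
      by (auto elim!: has_derivative_subset)
  qed
  then obtain x where "x \<in> {s<..<t}" "f t - f s = f' x * (t - s)" by auto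
  then show ?thesis using f'_ge[of x] \<open>a \<le> s\<close> \<open>s < t\<close> by (auto intro!: mult_right_mono)
qed simp

lemma quotient_tends_to_infinity:
  fixes u v :: "real \<Rightarrow> real"
  assumes u: "\<And>x. x \<ge> a \<Longrightarrow> (u has_real_derivative u' x) (at x within {a..})"
    and v: "\<And>x. x \<ge> a \<Longrightarrow> (v has_real_derivative v' x) (at x within {a..})"
    and wronskian: "\<And>x. x \<ge> a \<Longrightarrow> u x * v' x - u' x * v x = 1"
    and nonzero: "\<And>x. x \<ge> a \<Longrightarrow> u x \<noteq> 0"
    and bnd: "\<And>x. x \<ge> a \<Longrightarrow> \<bar>u x\<bar> \<le> M"
  shows "filterlim (\<lambda>x. v x / u x) at_top at_top"
proof -
  have "M > 0" using nonzero[of a] bnd[of a] by auto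
  have quot: "((\<lambda>x. v x / u x) has_real_derivative 1 / (u x)\<^sup>2) (at x within {a..})"
    if "x \<ge> a" for x
    by (rule DERIV_cong[OF DERIV_divide[OF v[OF that] u[OF that] nonzero[OF that]]])
      (use wronskian[OF that] in \<open>simp add: power2_eq_square algebra_simps\<close>)
  have "1 / (u x)\<^sup>2 \<ge> 1 / M\<^sup>2" if "x \<ge> a" for x
    using power_mono[OF bnd[OF that], of 2] nonzero[OF that] by (simp add: frac_le)
  then have "v x / u x - v a / u a \<ge> 1 / M\<^sup>2 * (x - a)" if "x \<ge> a" for x
    using increment_ge_of_derivative_ge[OF quot, of "1 / M\<^sup>2" a x] that by simp
  then have "\<forall>\<^sub>F x in at_top. 1 / M\<^sup>2 * (x - a) + v a / u a \<le> v x / u x"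
    by (intro eventually_at_top_linorderI[of a]) (simp add: algebra_simps)
  moreover have "filterlim (\<lambda>x. 1 / M\<^sup>2 * (x - a) + v a / u a) at_top at_top"
    unfolding filterlim_at_top
  proof
    fix Z
    show "\<forall>\<^sub>F x in at_top. Z \<le> 1 / M\<^sup>2 * (x - a) + v a / u a"
      using \<open>M > 0\<close>
      by (intro eventually_at_top_linorderI[of "a + M\<^sup>2 * (Z - v a / u a)"])
        (simp add: field_simps)
  qed
  ultimately show ?thesis by (rule filterlim_at_top_mono[rotated])
qed

section \<open>A second solution\<close>

text \<open>
  With \<open>\<rho> = \<phi>\<^sup>2 + \<phi>'\<^sup>2\<close> one has \<open>\<rho>' = 2 \<phi> \<phi>' (1 - r)\<close>, hence \<open>\<bar>\<rho>'\<bar> \<le> \<bar>1 - r\<bar> \<rho>\<close>. If \<open>R\<close> is an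
  antiderivative of \<open>\<bar>1 - r\<bar>\<close>, then \<open>\<rho> e\<^sup>R\<close> increases and \<open>\<rho> e\<^sup>-\<^sup>R\<close> decreases, so a positive
  value of \<open>\<rho>\<close> at one point propagates in both directions.
\<close>
lemma energy_positive:
  fixes r \<phi> \<phi>' :: "real \<Rightarrow> real"
  assumes r: "continuous_on {a..} r"
    and d1: "\<And>x. x \<ge> a \<Longrightarrow> (\<phi> has_real_derivative \<phi>' x) (at x within {a..})"
    and d2: "\<And>x. x \<ge> a \<Longrightarrow> (\<phi>' has_real_derivative - r x * \<phi> x) (at x within {a..})"
    and p: "p \<ge> a" "\<phi> p \<noteq> 0"
    and t: "t \<ge> a"
  shows "(\<phi> t)\<^sup>2 + (\<phi>' t)\<^sup>2 > 0"
proof -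
  define \<rho> where "\<rho> x = (\<phi> x)\<^sup>2 + (\<phi>' x)\<^sup>2" for x
  define \<rho>' where "\<rho>' x = 2 * \<phi> x * \<phi>' x * (1 - r x)" for x
  have "continuous_on {a..} (\<lambda>x. \<bar>1 - r x\<bar>)" by (intro continuous_intros r)
  then obtain R where
    R: "\<And>x. x \<ge> a \<Longrightarrow> (R has_real_derivative \<bar>1 - r x\<bar>) (at x within {a..})"
    by (rule antiderivative_on_half_line) blast
  have \<rho>: "(\<rho> has_real_derivative \<rho>' x) (at x within {a..})" if "x \<ge> a" for x
    unfolding \<rho>_def[abs_def] \<rho>'_def
    by (rule derivative_eq_intros d1[OF that] d2[OF that] refl)+ (simp add: algebra_simps)
  have bound: "\<bar>\<rho>' x\<bar> \<le> \<bar>1 - r x\<bar> * \<rho> x" for x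
  proof -
    have "2 * \<bar>\<phi> x\<bar> * \<bar>\<phi>' x\<bar> \<le> \<rho> x"
      using sum_squares_bound[of "\<bar>\<phi> x\<bar>" "\<bar>\<phi>' x\<bar>"] by (simp add: \<rho>_def)
    then show ?thesis
      unfolding \<rho>'_def abs_mult by (subst mult.commute) (simp add: mult_left_mono)
  qed
  have inc: "\<rho> x * exp (R x) \<le> \<rho> y * exp (R y)" if "a \<le> x" "x \<le> y" for x y
  proof -
    have "((\<lambda>z. \<rho> z * exp (R z)) has_real_derivative
        (\<rho>' z + \<bar>1 - r z\<bar> * \<rho> z) * exp (R z)) (at z within {a..})" if "z \<ge> a" for z
      by (rule derivative_eq_intros \<rho>[OF that] R[OF that] refl)+ (simp add: algebra_simps)
    moreover have "(\<rho>' z + \<bar>1 - r z\<bar> * \<rho> z) * exp (R z) \<ge> 0" for z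
      using bound[of z] by (intro mult_nonneg_nonneg) auto
    ultimately show ?thesis
      using increment_ge_of_derivative_ge[where k = 0, OF _ _ that] by fastforce
  qed
  have dec: "\<rho> y * exp (- R y) \<le> \<rho> x * exp (- R x)" if "a \<le> x" "x \<le> y" for x y
  proof -
    have "((\<lambda>z. - (\<rho> z * exp (- R z))) has_real_derivative
        (\<bar>1 - r z\<bar> * \<rho> z - \<rho>' z) * exp (- R z)) (at z within {a..})" if "z \<ge> a" for z
      by (rule derivative_eq_intros \<rho>[OF that] R[OF that] refl)+ (simp add: algebra_simps)
    moreover have "(\<bar>1 - r z\<bar> * \<rho> z - \<rho>' z) * exp (- R z) \<ge> 0" for z
      using bound[of z] by (intro mult_nonneg_nonneg) auto
    ultimately show ?thesis
      using increment_ge_of_derivative_ge[where k = 0, OF _ _ that] by fastforce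
  qed
  have "\<rho> p > 0" using p by (simp add: \<rho>_def add_pos_nonneg)
  then have pos: "\<rho> p * exp (R p) > 0" "\<rho> p * exp (- R p) > 0" by simp_all
  have "\<rho> t > 0"
  proof (cases "p \<le> t")
    case True
    then have "\<rho> t * exp (R t) > 0" using inc[of p t] p pos by linarith
    then show ?thesis by (simp add: zero_less_mult_iff)
  next
    case False
    then have "\<rho> t * exp (- R t) > 0" using dec[of t p] t pos by linarith
    then show ?thesis by (simp add: zero_less_mult_iff)
  qed
  then show ?thesis by (simp add: \<rho>_def)
qed

text \<open>
  The vector \<open>(-\<phi>', \<phi>) / \<rho>\<close> has determinant 1 against \<open>(\<phi>, \<phi>')\<close>, and adding a multiple
  \<open>c (\<phi>, \<phi>')\<close> does not change that. Requiring the sum to be of the form \<open>(\<psi>, \<psi>')\<close> with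
  \<open>\<psi>'' = - r \<psi>\<close> gives two equations for \<open>c'\<close>, one multiplied by \<open>\<phi>\<close> and one by \<open>\<phi>'\<close>; both
  hold when \<open>c' = (1 - r) (\<phi>\<^sup>2 - \<phi>'\<^sup>2) / \<rho>\<^sup>2\<close>.
\<close>
lemma unit_wronskian_partner:
  fixes r \<phi> \<phi>' :: "real \<Rightarrow> real"
  assumes r: "continuous_on {a..} r"
    and d1: "\<And>x. x \<ge> a \<Longrightarrow> (\<phi> has_real_derivative \<phi>' x) (at x within {a..})"
    and d2: "\<And>x. x \<ge> a \<Longrightarrow> (\<phi>' has_real_derivative - r x * \<phi> x) (at x within {a..})"
    and p: "p \<ge> a" "\<phi> p \<noteq> 0"
  obtains \<psi> \<psi>' where
    "\<And>x. x \<ge> a \<Longrightarrow> (\<psi> has_real_derivative \<psi>' x) (at x within {a..})"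
    "\<And>x. x \<ge> a \<Longrightarrow> (\<psi>' has_real_derivative - r x * \<psi> x) (at x within {a..})"
    "\<And>x. x \<ge> a \<Longrightarrow> \<phi> x * \<psi>' x - \<phi>' x * \<psi> x = 1"
proof -
  define \<rho> where "\<rho> x = (\<phi> x)\<^sup>2 + (\<phi>' x)\<^sup>2" for x
  have \<rho>_nz: "\<rho> x \<noteq> 0" if "x \<ge> a" for x
    using energy_positive[OF r d1 d2 p that] by (metis \<rho>_def less_irrefl)
  have d\<rho>: "(\<rho> has_real_derivative 2 * \<phi> x * \<phi>' x * (1 - r x)) (at x within {a..})"
    if "x \<ge> a" for x
    unfolding \<rho>_def[abs_def]
    by (rule derivative_eq_intros d1[OF that] d2[OF that] refl)+ (simp add: algebra_simps)
  have "continuous_on {a..} \<phi>" "continuous_on {a..} \<phi>'" "continuous_on {a..} \<rho>"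
    using d1 d2 d\<rho> by (auto intro!: DERIV_continuous_on)
  then have "continuous_on {a..} (\<lambda>x. (1 - r x) * ((\<phi> x)\<^sup>2 - (\<phi>' x)\<^sup>2) / (\<rho> x)\<^sup>2)"
    using r \<rho>_nz by (intro continuous_intros) auto
  then obtain c where c: "\<And>x. x \<ge> a \<Longrightarrow> (c has_real_derivative
      (1 - r x) * ((\<phi> x)\<^sup>2 - (\<phi>' x)\<^sup>2) / (\<rho> x)\<^sup>2) (at x within {a..})"
    by (rule antiderivative_on_half_line) blast
  show ?thesis
  proof (rule that[of "\<lambda>x. c x * \<phi> x - \<phi>' x / \<rho> x" "\<lambda>x. c x * \<phi>' x + \<phi> x / \<rho> x"])
    fix x assume x: "x \<ge> a"
    have \<rho>x: "\<rho> x = (\<phi> x)\<^sup>2 + (\<phi>' x)\<^sup>2" by (simp add: \<rho>_def)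
    note nz = \<rho>_nz[OF x]
    have "((1 - r x) * ((\<phi> x)\<^sup>2 - (\<phi>' x)\<^sup>2) / (\<rho> x)\<^sup>2 * \<phi> x + \<phi>' x * c x)
        - (- r x * \<phi> x * \<rho> x - \<phi>' x * (2 * \<phi> x * \<phi>' x * (1 - r x))) / (\<rho> x * \<rho> x)
        = c x * \<phi>' x + \<phi> x / \<rho> x"
      using nz by (simp add: divide_simps) (simp add: \<rho>x power2_eq_square algebra_simps)
    then show "((\<lambda>x. c x * \<phi> x - \<phi>' x / \<rho> x) has_real_derivative
        c x * \<phi>' x + \<phi> x / \<rho> x) (at x within {a..})"
      by (rule DERIV_cong[OF DERIV_diff[OF DERIV_mult[OF c[OF x] d1[OF x]]
            DERIV_divide[OF d2[OF x] d\<rho>[OF x] nz]]])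
    have "((1 - r x) * ((\<phi> x)\<^sup>2 - (\<phi>' x)\<^sup>2) / (\<rho> x)\<^sup>2 * \<phi>' x + - r x * \<phi> x * c x)
        + (\<phi>' x * \<rho> x - \<phi> x * (2 * \<phi> x * \<phi>' x * (1 - r x))) / (\<rho> x * \<rho> x)
        = - r x * (c x * \<phi> x - \<phi>' x / \<rho> x)"
      using nz by (simp add: divide_simps) (simp add: \<rho>x power2_eq_square algebra_simps)
    then show "((\<lambda>x. c x * \<phi>' x + \<phi> x / \<rho> x) has_real_derivative
        - r x * (c x * \<phi> x - \<phi>' x / \<rho> x)) (at x within {a..})"
      by (rule DERIV_cong[OF DERIV_add[OF DERIV_mult[OF c[OF x] d2[OF x]]
            DERIV_divide[OF d1[OF x] d\<rho>[OF x] nz]]])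
    show "\<phi> x * (c x * \<phi>' x + \<phi> x / \<rho> x) - \<phi>' x * (c x * \<phi> x - \<phi>' x / \<rho> x) = 1"
      using nz by (simp add: divide_simps) (simp add: \<rho>x power2_eq_square algebra_simps)
  qed
qed

section \<open>Bounded solutions with unit Wronskian\<close>

lemma solution_cases:
  assumes "solution r a \<phi>"
  obtains \<phi>' where
    "\<And>x. x \<ge> a \<Longrightarrow> (\<phi> has_real_derivative \<phi>' x) (at x within {a..})"
    "\<And>x. x \<ge> a \<Longrightarrow> (\<phi>' has_real_derivative - r x * \<phi> x) (at x within {a..})"
proof -
  obtain \<phi>' \<phi>'' where *: "\<And>x. x \<ge> a \<Longrightarrow> (\<phi> has_real_derivative \<phi>' x) (at x within {a..}) \<and>
      (\<phi>' has_real_derivative \<phi>'' x) (at x within {a..}) \<and> \<phi>'' x + r x * \<phi> x = 0"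
    using assms unfolding solution_def by blast
  then have "\<phi>'' x = - r x * \<phi> x" if "x \<ge> a" for x
    using that by (simp add: eq_neg_iff_add_eq_0)
  then show ?thesis using that[of \<phi>'] * by metis
qed

text \<open>
  Both \<open>v / u\<close> and \<open>-u / v\<close> would tend to infinity if \<open>u\<close> had no zeros beyond \<open>b\<close>.
\<close>
lemma bounded_unit_wronskian_zeros:
  fixes u v :: "real \<Rightarrow> real"
  assumes u: "\<And>x. x \<ge> a \<Longrightarrow> (u has_real_derivative u' x) (at x within {a..})"
    and v: "\<And>x. x \<ge> a \<Longrightarrow> (v has_real_derivative v' x) (at x within {a..})"
    and wronskian: "\<And>x. x \<ge> a \<Longrightarrow> u x * v' x - u' x * v x = 1"
    and u_le: "\<And>x. x \<ge> a \<Longrightarrow> \<bar>u x\<bar> \<le> M"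
    and v_le: "\<And>x. x \<ge> a \<Longrightarrow> \<bar>v x\<bar> \<le> N"
  shows "\<exists>x\<ge>a. x \<ge> b \<and> u x = 0"
proof (rule ccontr)
  assume "\<not> ?thesis"
  then have u_nz: "u x \<noteq> 0" if "x \<ge> max a b" for x using that by auto
  have restrict: "(f has_real_derivative D) (at x within {k..})"
    if "(f has_real_derivative D) (at x within {a..})" "k \<ge> a" for f D x k
    by (rule DERIV_subset[OF that(1)]) (use that(2) in auto)
  have lim1: "filterlim (\<lambda>x. v x / u x) at_top at_top"
  proof (rule quotient_tends_to_infinity[where a = "max a b" and M = M])
    show "(u has_real_derivative u' x) (at x within {max a b..})" if "x \<ge> max a b" for x
      using u[of x] that by (auto intro: restrict)
    show "(v has_real_derivative v' x) (at x within {max a b..})" if "x \<ge> max a b" for x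
      using v[of x] that by (auto intro: restrict)
  qed (use wronskian u_nz u_le in auto)
  then have "\<forall>\<^sub>F x in at_top. 1 \<le> v x / u x" by (simp add: filterlim_at_top)
  then obtain k0 where k0: "\<And>x. x \<ge> k0 \<Longrightarrow> 1 \<le> v x / u x"
    unfolding eventually_at_top_linorder by blast
  define k where "k = max a k0"
  have "filterlim (\<lambda>x. - u x / v x) at_top at_top"
  proof (rule quotient_tends_to_infinity[where a = k and M = N])
    show "(v has_real_derivative v' x) (at x within {k..})" if "x \<ge> k" for x
      using v[of x] that by (auto simp: k_def intro: restrict)
    show "((\<lambda>x. - u x) has_real_derivative - u' x) (at x within {k..})" if "x \<ge> k" for x
      using u[of x] that by (auto simp: k_def intro!: restrict DERIV_minus)
    show "v x * - u' x - v' x * - u x = 1" if "x \<ge> k" for x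
      using wronskian[of x] that by (simp add: k_def algebra_simps)
    show "v x \<noteq> 0" if "x \<ge> k" for x
      using k0[of x] that by (auto simp: k_def)
  qed (use v_le in \<open>auto simp: k_def\<close>)
  then have "\<forall>\<^sub>F x in at_top. 1 \<le> - u x / v x" unfolding filterlim_at_top by blast
  then obtain x where x: "x \<ge> k" "1 \<le> - u x / v x"
    unfolding eventually_at_top_linorder by (metis max.cobounded1 max.cobounded2)
  have "1 \<le> v x / u x" using k0[of x] x by (simp add: k_def)
  moreover have "- u x / v x * (v x / u x) \<le> 0" by simp
  ultimately show False using x(2) mult_mono[of 1 "- u x / v x" 1 "v x / u x"] by linarith
qed

theorem mainTheorem2:
  fixes r :: "real \<Rightarrow> real" and t0 :: real
  assumes "continuous_on {t0..} r"
    and "\<And>\<phi>. solution r t0 \<phi> \<Longrightarrow> bounded (\<phi> ` {t0..})"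
  shows "oscillatory r t0 \<and>
    (\<forall>\<phi>. nontrivial_solution r t0 \<phi> \<longrightarrow> \<not> (deriv \<phi> \<longlongrightarrow> 0) at_top)"
proof -
  have bounded_solution: "\<exists>M. \<forall>x\<ge>t0. \<bar>\<phi> x\<bar> \<le> M" if "solution r t0 \<phi>" for \<phi>
    using assms(2)[OF that] by (auto simp: bounded_iff)
  have "(\<forall>T. \<exists>t\<ge>t0. t \<ge> T \<and> \<phi> t = 0) \<and> \<not> (deriv \<phi> \<longlongrightarrow> 0) at_top"
    if nontrivial: "nontrivial_solution r t0 \<phi>" for \<phi>
  proof -
    from nontrivial have sol: "solution r t0 \<phi>" by (simp add: nontrivial_solution_def)
    from nontrivial obtain p where p: "p \<ge> t0" "\<phi> p \<noteq> 0"
      by (auto simp: nontrivial_solution_def)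
    obtain \<phi>' where
      \<phi>: "\<And>x. x \<ge> t0 \<Longrightarrow> (\<phi> has_real_derivative \<phi>' x) (at x within {t0..})" and
      \<phi>': "\<And>x. x \<ge> t0 \<Longrightarrow> (\<phi>' has_real_derivative - r x * \<phi> x) (at x within {t0..})"
      using solution_cases[OF sol] by blast
    obtain \<psi> \<psi>' where
      \<psi>: "\<And>x. x \<ge> t0 \<Longrightarrow> (\<psi> has_real_derivative \<psi>' x) (at x within {t0..})" and
      \<psi>': "\<And>x. x \<ge> t0 \<Longrightarrow> (\<psi>' has_real_derivative - r x * \<psi> x) (at x within {t0..})" and
      wronskian: "\<And>x. x \<ge> t0 \<Longrightarrow> \<phi> x * \<psi>' x - \<phi>' x * \<psi> x = 1"
      using unit_wronskian_partner[OF assms(1) \<phi> \<phi>' p] by blast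
    have "solution r t0 \<psi>"
      unfolding solution_def
      by (rule exI[of _ \<psi>'], rule exI[of _ "\<lambda>x. - r x * \<psi> x"]) (use \<psi> \<psi>' in auto)
    then obtain N where N: "\<And>x. x \<ge> t0 \<Longrightarrow> \<bar>\<psi> x\<bar> \<le> N"
      using bounded_solution by blast
    obtain M where M: "\<And>x. x \<ge> t0 \<Longrightarrow> \<bar>\<phi> x\<bar> \<le> M"
      using bounded_solution[OF sol] by blast
    have zeros: "\<exists>t\<ge>t0. t \<ge> T \<and> \<phi> t = 0" for T
      by (rule bounded_unit_wronskian_zeros[OF \<phi> \<psi> wronskian M N])
    have "\<not> (deriv \<phi> \<longlongrightarrow> 0) at_top"
    proof
      assume lim: "(deriv \<phi> \<longlongrightarrow> 0) at_top"
      have "N \<ge> 0" using N[of t0] by linarith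
      have "\<forall>\<^sub>F x in at_top. dist (deriv \<phi> x) 0 < 1 / (N + 1)"
        by (rule tendstoD[OF lim]) (use \<open>N \<ge> 0\<close> in simp)
      then obtain k where k: "\<And>x. x \<ge> k \<Longrightarrow> \<bar>deriv \<phi> x\<bar> < 1 / (N + 1)"
        unfolding eventually_at_top_linorder by auto
      obtain x where x: "x \<ge> max k (t0 + 1)" "\<phi> x = 0" using zeros by blast
      then have "x \<ge> t0" "x > t0" "x \<ge> k" by auto
      have "at x within {t0..} = at x"
        using \<open>x > t0\<close> by (intro at_within_interior) (simp add: interior_real_atLeast)
      then have "deriv \<phi> x = \<phi>' x" using \<phi>[OF \<open>x \<ge> t0\<close>] by (simp add: DERIV_imp_deriv)
      then have "\<bar>\<phi>' x\<bar> < 1 / (N + 1)" using k[OF \<open>x \<ge> k\<close>] by simp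
      then have "\<bar>\<phi>' x\<bar> * \<bar>\<psi> x\<bar> \<le> 1 / (N + 1) * N"
        using N[OF \<open>x \<ge> t0\<close>] \<open>N \<ge> 0\<close> by (intro mult_mono) auto
      also have "\<dots> < 1" using \<open>N \<ge> 0\<close> by simp
      finally have "\<bar>\<phi>' x * \<psi> x\<bar> < 1" by (simp add: abs_mult)
      moreover have "\<phi>' x * \<psi> x = - 1" using wronskian[OF \<open>x \<ge> t0\<close>] x(2) by simp
      ultimately show False by simp
    qed
    with zeros show ?thesis by blast
  qed
  then show ?thesis unfolding oscillatory_def by blast
qed

end
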